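(* Let $d,D$ be positive integers with $D\geq4d+2$, and let $\phi$, $\phi_{c}$, $F_{c}$, $K$, $K^{+}$, $a_{0}$ be as in the context (in particular satisfying all the standing assumptions listed there). Then, for Lebesgue-almost every $c$ in the open ball $\{c\in\mathbb{R}^{D_{\alpha}}:\|c\|<a_{0}\}$, the delay map $F_{c}$ is injective on $K$; that is, the set of $c$ with $\|c\|<a_{0}$ for which $F_{c}|_{K}$ is injective has probability one relative to this ball.
   Context: Notation: $\pi_{i}$ denotes projection of $\mathbb{R}^{d}$ onto the $i$-th coordinate and $\mathbf{e}_{1}=(1,0,\ldots,0)\in\mathbb{R}^{d}$. For a multi-index $\alpha=(\alpha_{1},\ldots,\alpha_{d})\in\mathbb{Z}_{\geq0}^{d}$, $p_{\alpha}(x)=\prod_{i=1}^{d}(\pi_{i}x)^{\alpha_{i}}$ and $|\alpha|=\sum_i\alpha_i$. Let $\mathcal{I}_{2D-1}$ be the set of multi-indices with $|\alpha|\leq2D-1$ and $D_{\alpha}$ its cardinality; parameters are vectors $c=(c_{\alpha})_{\alpha\in\mathcal{I}_{2D-1}}\in\mathbb{R}^{D_{\alpha}}$ with the Euclidean norm. Let $\phi:\mathbb{R}^{d}\to\mathbb{R}^{d}$ be a diffeomorphism and define $\phi_{c}(x)=\phi(x)+\mathbf{e}_{1}\sum_{\alpha\in\mathcal{I}_{2D-1}}c_{\alpha}p_{\alpha}(x)$. The delay map is $F_{c}(x)=(\pi_{1}x,\pi_{1}\phi_{c}(x),\ldots,\pi_{1}\phi_{c}^{D-1}(x))\in\mathbb{R}^{D}$.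 Standing assumptions: $K$ is a compact ball in $\mathbb{R}^{d}$ centered at the origin; $K^{+}$ is a larger compact ball containing $K$ such that $\phi^{j}(x)\in K^{+}$ for all $x\in K$, $0\leq j\leq D-1$; $a_{0}>0$ is so small that $\phi_{c}^{j}(x)\in K^{+}$ for all $x\in K$, $0\leq j\leq D-1$, $\|c\|\leq a_{0}$. Moreover, for every $\|c\|\leq a_{0}$: (1) $\phi_{c}$ is a $C^{3}$ diffeomorphism of $\mathbb{R}^{d}$; (2) $\phi_{c}$ has exactly $m$ fixed points, denoted $\xi_{1}(c),\ldots,\xi_{m}(c)$ (labelled consistently in $c$); (3) $\phi_{c}$ has no other periodic points of period less than $2D$; (4) all fixed points are hyperbolic and $\pi_{1}\xi_{i}(c)\neq\pi_{1}\xi_{j}(c)$ for $i\neq j$; (5) $F_{c}$ is immersive (has injective derivative) at each fixed point. "Probability of $A$ relative to $B$" means $\mu(A\cap B)/\mu(B)$ with $\mu$ Lebesgue measure. *)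

theory Defs
  imports "HOL-Analysis.Analysis"
begin

text \<open>Points of R^d are vectors of type real^'n, with d = CARD('n).
  The distinguished "first" coordinate is a fixed index i1 :: 'n.
  Multi-indices are functions 'n => nat.\<close>

definition multi_indices :: "nat \<Rightarrow> ('n::finite \<Rightarrow> nat) set" where
  "multi_indices N = {\<alpha>. sum \<alpha> UNIV \<le> N}"

definition monom :: "('n::finite \<Rightarrow> nat) \<Rightarrow> real^'n \<Rightarrow> real" where
  "monom \<alpha> x = (\<Prod>i\<in>UNIV. (x $ i) ^ (\<alpha> i))"

definition pnorm :: "'i set \<Rightarrow> ('i \<Rightarrow> real) \<Rightarrow> real" where
  "pnorm I c = sqrt (\<Sum>a\<in>I. (c a)^2)"

definition phi_c :: "'n::finite \<Rightarrow> nat \<Rightarrow> (real^'n \<Rightarrow> real^'n) \<Rightarrow> (('n \<Rightarrow> nat) \<Rightarrow> real)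
     \<Rightarrow> real^'n \<Rightarrow> real^'n" where
  "phi_c i1 D \<phi> c x = \<phi> x + (\<Sum>\<alpha>\<in>multi_indices (2*D-1). c \<alpha> * monom \<alpha> x) *\<^sub>R axis i1 1"

definition delay_map :: "'n::finite \<Rightarrow> nat \<Rightarrow> (real^'n \<Rightarrow> real^'n) \<Rightarrow> (('n \<Rightarrow> nat) \<Rightarrow> real)
     \<Rightarrow> real^'n \<Rightarrow> real list" where
  "delay_map i1 D \<phi> c x = map (\<lambda>j. ((phi_c i1 D \<phi> c ^^ j) x) $ i1) [0..<D]"

fun iter_dderiv :: "('a::real_normed_vector \<Rightarrow> 'b::real_normed_vector) \<Rightarrow> 'a list \<Rightarrow> 'a \<Rightarrow> 'b" where
  "iter_dderiv f [] = f"
| "iter_dderiv f (v # vs) = (\<lambda>x. frechet_derivative (iter_dderiv f vs) (at x) v)"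

definition Ck :: "nat \<Rightarrow> ('a::euclidean_space \<Rightarrow> 'b::real_normed_vector) \<Rightarrow> bool" where
  "Ck k f \<longleftrightarrow> (\<forall>vs. length vs < k \<longrightarrow> (\<forall>x. iter_dderiv f vs differentiable (at x)))
              \<and> (\<forall>vs. length vs \<le> k \<longrightarrow> continuous_on UNIV (iter_dderiv f vs))"

definition Ck_diffeo :: "nat \<Rightarrow> ('a::euclidean_space \<Rightarrow> 'a) \<Rightarrow> bool" where
  "Ck_diffeo k f \<longleftrightarrow> bij f \<and> Ck k f \<and> Ck k (inv f)"

definition diffeo :: "('a::euclidean_space \<Rightarrow> 'a) \<Rightarrow> bool" where
  "diffeo f \<longleftrightarrow> Ck_diffeo 1 f"

definition hyperbolic_fixpoint :: "(real^'n::finite \<Rightarrow> real^'n) \<Rightarrow> real^'n \<Rightarrow> bool" where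
  "hyperbolic_fixpoint f p \<longleftrightarrow> f p = p \<and> f differentiable (at p) \<and>
     (\<forall>z::complex. cmod z = 1 \<longrightarrow>
        det (\<chi> i j. complex_of_real (matrix (frechet_derivative f (at p)) $ i $ j)
                     - (if i = j then z else 0)) \<noteq> 0)"

definition delay_immersive :: "'n::finite \<Rightarrow> nat \<Rightarrow> (real^'n \<Rightarrow> real^'n) \<Rightarrow> real^'n \<Rightarrow> bool" where
  "delay_immersive i1 D f p \<longleftrightarrow>
     (\<forall>j<D. (\<lambda>x. (f ^^ j) x $ i1) differentiable (at p)) \<and>
     (\<forall>v. (\<forall>j<D. frechet_derivative (\<lambda>x. (f ^^ j) x $ i1) (at p) v = 0) \<longrightarrow> v = 0)"

end

theory Submission
  imports Defs
begin

text \<open>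
  Write $x_j$ and $y_j$ for the orbits of two distinct points with equal delay vectors. Not both points
  are fixed, so the absence of short periodic orbits forces, after possibly exchanging the two
  points, $x_k$ to be different from all $x_j$ with $j < k$ and all $y_j$ with $j \le k$. Hence
  there are admissible polynomials $g_k$ that equal 1 at $x_k$ and vanish at these other points,
  and perturbing the parameter along $g_0, g_1, \ldots$ changes the delay differences in a
  unit triangular way. Near such a configuration any two parameters in the span of $2d+1$ of these
  directions that admit points with equal delays therefore differ by at most a constant times the
  distance between the corresponding pairs of points: each slice of the bad set is a Lipschitz
  image of a subset of $R^{2d}$ and so is null in dimension $2d+1$. Fubini and
  Lindelof's theorem conclude.
\<close>

section \<open>Null sets of product Lebesgue measure\<close>

text \<open>Boxes determine the product measure, and on a box the claim is translation invariance of
  \<open>lborel\<close> in each coordinate. The restriction to \<open>I\<close> keeps translates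
  among the extensional functions that carry \<open>PiM\<close>.\<close>

lemma distr_PiM_lborel_translation:
  fixes w :: "'i \<Rightarrow> real"
  assumes "finite I"
  shows "distr (PiM I (\<lambda>_. lborel)) (PiM I (\<lambda>_. lborel)) (\<lambda>c. \<lambda>i\<in>I. c i + w i)
         = PiM I (\<lambda>_. lborel)"
proof -
  interpret product_sigma_finite "\<lambda>_::'i. lborel :: real measure" ..
  let ?M = "PiM I (\<lambda>_. lborel) :: ('i \<Rightarrow> real) measure"
  have meas [measurable]: "(\<lambda>c. \<lambda>i\<in>I. c i + w i) \<in> measurable ?M ?M"
    by measurable
  show ?thesis
  proof (rule PiM_eqI)
    fix A :: "'i \<Rightarrow> real set" assume A: "\<And>i. i \<in> I \<Longrightarrow> A i \<in> sets lborel"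
    have tr: "(\<lambda>x. x + w i) -` A i \<in> sets lborel" if "i \<in> I" for i
      using measurable_sets[of "\<lambda>x. x + w i" lborel borel "A i"] A[OF that] by simp
    have inv: "emeasure lborel ((\<lambda>x. x + w i) -` A i) = emeasure lborel (A i)" if "i \<in> I" for i
    proof -
      have "emeasure lborel (A i) = emeasure (distr lborel borel ((+) (w i))) (A i)"
        by (simp add: lborel_distr_plus)
      also have "\<dots> = emeasure lborel ((+) (w i) -` A i)"
        using A[OF that] by (subst emeasure_distr) auto
      also have "(+) (w i) = (\<lambda>x. x + w i)"
        by (auto simp: add.commute)
      finally show ?thesis by simp
    qed
    have "emeasure (distr ?M ?M (\<lambda>c. \<lambda>i\<in>I. c i + w i)) (Pi\<^sub>E I A)
        = emeasure ?M ((\<lambda>c. \<lambda>i\<in>I. c i + w i) -` (Pi\<^sub>E I A) \<inter> space ?M)"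
      using A assms by (subst emeasure_distr) (auto intro!: sets_PiM_I_finite)
    also have "(\<lambda>c. \<lambda>i\<in>I. c i + w i) -` (Pi\<^sub>E I A) \<inter> space ?M
        = Pi\<^sub>E I (\<lambda>i. (\<lambda>x. x + w i) -` A i)"
      by (auto simp: space_PiM PiE_iff)
    also have "emeasure ?M \<dots> = (\<Prod>i\<in>I. emeasure lborel (A i))"
      using tr assms by (subst emeasure_PiM) (auto simp: inv)
    finally show "emeasure (distr ?M ?M (\<lambda>c. \<lambda>i\<in>I. c i + w i)) (Pi\<^sub>E I A)
        = (\<Prod>i\<in>I. emeasure lborel (A i))" .
  qed (use assms in auto)
qed

text \<open>Fubini on the pairs \<open>(s, c)\<close> for which the translate of \<open>c\<close> by
  \<open>w s\<close> lies in \<open>B\<close>: the sections at fixed \<open>s\<close> all have the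
  measure of \<open>B\<close>, the sections at fixed \<open>c\<close> are null.\<close>

lemma null_sets_PiM_if_null_slices:
  fixes w :: "'s::euclidean_space \<Rightarrow> 'i \<Rightarrow> real"
  assumes I: "finite I" and B: "B \<in> sets (PiM I (\<lambda>_. lborel))"
    and w [measurable]: "\<And>i. i \<in> I \<Longrightarrow> (\<lambda>s. w s i) \<in> borel_measurable borel"
    and slice: "\<And>c. c \<in> space (PiM I (\<lambda>_. lborel)) \<Longrightarrow> negligible {s. (\<lambda>i\<in>I. c i + w s i) \<in> B}"
  shows "B \<in> null_sets (PiM I (\<lambda>_. lborel))"
proof -
  let ?M = "PiM I (\<lambda>_. lborel) :: ('i \<Rightarrow> real) measure"
  let ?T = "\<lambda>(s, c). \<lambda>i\<in>I. c i + w s i"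
  interpret product_sigma_finite "\<lambda>_::'i. lborel :: real measure" ..
  interpret M: sigma_finite_measure ?M
    using I by (rule sigma_finite)
  interpret P: pair_sigma_finite "lborel :: 's measure" ?M ..
  have T: "?T \<in> measurable ((lborel :: 's measure) \<Otimes>\<^sub>M ?M) ?M"
    by measurable
  define Q where "Q = ?T -` B \<inter> space ((lborel :: 's measure) \<Otimes>\<^sub>M ?M)"
  have Q: "Q \<in> sets ((lborel :: 's measure) \<Otimes>\<^sub>M ?M)"
    unfolding Q_def using T B by (rule measurable_sets)
  have s1: "emeasure ?M (Pair s -` Q) = emeasure ?M B" for s
  proof -
    have "emeasure ?M B = emeasure (distr ?M ?M (\<lambda>c. \<lambda>i\<in>I. c i + w s i)) B"
      by (simp add: distr_PiM_lborel_translation[OF I])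
    also have "\<dots> = emeasure ?M ((\<lambda>c. \<lambda>i\<in>I. c i + w s i) -` B \<inter> space ?M)"
      using B by (subst emeasure_distr) auto
    also have "(\<lambda>c. \<lambda>i\<in>I. c i + w s i) -` B \<inter> space ?M = Pair s -` Q"
      by (auto simp: Q_def space_pair_measure)
    finally show ?thesis by simp
  qed
  have s2: "emeasure lborel ((\<lambda>s. (s, c)) -` Q) = 0" if c: "c \<in> space ?M" for c
  proof -
    have eq: "(\<lambda>s. (s, c)) -` Q = {s. (\<lambda>i\<in>I. c i + w s i) \<in> B}"
      using c by (auto simp: Q_def space_pair_measure)
    \<comment> \<open>Negligibility speaks of the completed measure; Borel measurability of the
      section carries it over to \<open>lborel\<close>.\<close>
    have "(\<lambda>s. (s, c)) -` Q \<in> sets lborel"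
      using Q by (rule sets_Pair2)
    moreover have "emeasure lebesgue ((\<lambda>s. (s, c)) -` Q) = 0"
      using slice[OF c] unfolding eq by (simp add: negligible_iff_null_sets null_sets_def)
    ultimately show ?thesis by (simp add: emeasure_completion)
  qed
  have "emeasure (lborel \<Otimes>\<^sub>M ?M) Q = (\<integral>\<^sup>+s. emeasure ?M B \<partial>(lborel :: 's measure))"
    using M.emeasure_pair_measure_alt[OF Q] by (simp add: s1)
  moreover have "emeasure (lborel \<Otimes>\<^sub>M ?M) Q = (\<integral>\<^sup>+c. 0 \<partial>?M)"
    using P.emeasure_pair_measure_alt2[OF Q]
      nn_integral_cong[of ?M "\<lambda>c. emeasure lborel ((\<lambda>s. (s, c)) -` Q)" "\<lambda>_. 0"] s2 by metis
  \<comment> \<open>The second factor is infinite, so the product vanishes only if the first factor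
    does.\<close>
  ultimately have "emeasure ?M B * emeasure (lborel :: 's measure) UNIV = 0"
    by simp
  then have "emeasure ?M B = 0"
    by (simp add: emeasure_lborel_UNIV)
  with B show ?thesis by (simp add: null_sets_def)
qed

text \<open>The extra real factor makes the parameter space one dimension larger than the
  space of witnesses.\<close>
lemma negligible_if_Lipschitz_determined:
  fixes S :: "('a::euclidean_space \<times> real) set"
  assumes wit: "\<And>s. s \<in> S \<Longrightarrow> \<exists>z::'a. R s z"
    and Lip: "\<And>s s' z z'. R s z \<Longrightarrow> R s' z' \<Longrightarrow> norm (s - s') \<le> C * norm (z - z')"
  shows "negligible S"
proof -
  \<comment> \<open>The witnesses are placed in a hyperplane of the product with the line, which is
    null; \<open>f\<close> selects for each witness one parameter related to it.\<close>
  define T where "T = {z. \<exists>s. R s z} \<times> {0::real}"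
  define f where "f = (\<lambda>p::'a \<times> real. SOME s. R s (fst p))"
  have R: "R (f p) (fst p)" if "p \<in> T" for p
  proof -
    have "\<exists>s. R s (fst p)" using that unfolding T_def by force
    then show ?thesis unfolding f_def by (rule someI_ex)
  qed
  have "negligible {p :: 'a \<times> real. p \<bullet> (0, 1) = 0}"
    by (rule negligible_standard_hyperplane) (simp add: Basis_prod_def)
  then have "negligible T"
    by (rule negligible_subset) (auto simp: T_def)
  then have "negligible (f ` T)"
  proof (rule negligible_locally_Lipschitz_image[rotated])
    fix p assume p: "p \<in> T"
    have "norm (f q - f p) \<le> C * norm (q - p)" if "q \<in> T" for q
      using Lip[OF R[OF that] R[OF p]] that p by (auto simp: T_def norm_Pair)
    then show "\<exists>U B. open U \<and> p \<in> U \<and> (\<forall>q\<in>T \<inter> U. norm (f q - f p) \<le> B * norm (q - p))"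
      by (intro exI[of _ UNIV] exI[of _ C]) auto
  qed simp
  moreover have "S \<subseteq> f ` T"
  proof
    fix s assume "s \<in> S"
    then obtain z where z: "R s z" using wit by blast
    then have "(z, 0) \<in> T" unfolding T_def by blast
    \<comment> \<open>Equal witnesses force distance at most \<open>C * 0\<close>, so the selected
      parameter is \<open>s\<close> itself.\<close>
    moreover from Lip[OF z R[OF this]] have "s = f (z, 0)" by simp
    ultimately show "s \<in> f ` T" by blast
  qed
  ultimately show ?thesis by (rule negligible_subset)
qed

section \<open>Projections and Borel sets of parameters\<close>

text \<open>Projection along a compact factor is a closed map. This will make the set of parameters
  that admit a bad pair of points in a compact set measurable.\<close>

lemma closed_fst_image_compact:
  fixes Z :: "('a::topological_space \<times> 'b::topological_space) set"
  assumes "closed Z" "compact V"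
  shows "closed {c. \<exists>z\<in>V. (c, z) \<in> Z}"
proof -
  have "compact_space (top_of_set V)"
    using assms(2) by (simp add: compact_space_subtopology)
  from closed_map_fst[OF this, of "euclidean :: 'a topology"]
  have cm: "closed_map (top_of_set (UNIV \<times> V)) euclidean (fst :: 'a \<times> 'b \<Rightarrow> 'a)"
    by (metis prod_topology_subtopology_eu subtopology_UNIV)
  have "closedin (top_of_set (UNIV \<times> V)) (Z \<inter> (UNIV \<times> V))"
    using assms(1) by (auto simp: closedin_closed)
  with cm have "closed (fst ` (Z \<inter> (UNIV \<times> V)))"
    unfolding closed_map_def closed_closedin by blast
  moreover have "fst ` (Z \<inter> (UNIV \<times> V)) = {c. \<exists>z\<in>V. (c, z) \<in> Z}"
    by force
  ultimately show ?thesis by simp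
qed

text \<open>For a countable index type the product sigma-algebra over all indices is the Borel
  algebra of the product topology. Coordinates outside \<open>I\<close> are constantly
  \<open>undefined\<close> on the space, hence measurable.\<close>

lemma closed_Int_space_in_sets_PiM:
  fixes C :: "('i::countable \<Rightarrow> real) set"
  assumes "closed C"
  shows "C \<inter> space (PiM I (\<lambda>_. lborel)) \<in> sets (PiM I (\<lambda>_. lborel))"
proof -
  let ?M = "PiM I (\<lambda>_. lborel) :: ('i \<Rightarrow> real) measure"
  have "(\<lambda>c i. c i) \<in> measurable ?M (PiM UNIV (\<lambda>_. borel))"
  proof (rule measurable_PiM_single')
    fix i
    show "(\<lambda>c. c i) \<in> borel_measurable ?M"
    proof (cases "i \<in> I")
      case True
      then show ?thesis by measurable
    next
      case False
      then have "c i = undefined" if "c \<in> space ?M" for c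
        using that PiE_arb unfolding space_PiM by fast
      then have "(\<lambda>c. c i) \<in> borel_measurable ?M \<longleftrightarrow> (\<lambda>c. undefined :: real) \<in> borel_measurable ?M"
        by (rule measurable_cong)
      then show ?thesis by simp
    qed
  qed auto
  then have "(\<lambda>c. c) \<in> borel_measurable ?M"
    using measurable_cong_sets[OF refl sets_PiM_equal_borel] by blast
  from measurable_sets[OF this, of C] assms show ?thesis by simp
qed

section \<open>Lipschitz bounds\<close>

lemma Ck_mono:
  assumes "Ck k f" "k' \<le> k"
  shows "Ck k' f"
  using assms unfolding Ck_def by (meson le_trans less_le_trans)

text \<open>Mean value inequality on a convex set. \<open>Ck\<close> gives continuity of the
  derivative one direction at a time, so the operator norm is bounded through the finitely many
  basis directions.\<close>

lemma Ck_imp_lipschitz_on_compact_convex: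
  fixes f :: "'a::euclidean_space \<Rightarrow> 'b::real_normed_vector"
  assumes f: "Ck k f" and k: "k \<ge> 1" and S: "compact S" "convex S"
  shows "\<exists>L. L-lipschitz_on S f"
proof -
  let ?f' = "\<lambda>x. frechet_derivative f (at x)"
  have diff: "(f has_derivative ?f' x) (at x)" for x
  proof -
    have "iter_dderiv f [] differentiable (at x)"
      using f k unfolding Ck_def by (metis list.size(3) less_le_trans zero_less_one)
    then show ?thesis by (simp add: frechet_derivative_works)
  qed
  have "continuous_on UNIV (\<lambda>x. ?f' x v)" for v
  proof -
    have "continuous_on UNIV (iter_dderiv f [v])"
      using f k unfolding Ck_def by (metis One_nat_def length_Cons list.size(3))
    then show ?thesis by simp
  qed
  then have "bounded ((\<lambda>x. ?f' x v) ` S)" for v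
    using S(1) by (meson compact_continuous_image compact_imp_bounded continuous_on_subset subset_UNIV)
  then have "\<exists>B. \<forall>x\<in>S. norm (?f' x v) \<le> B" for v
    by (auto simp: bounded_iff)
  then obtain B where B: "\<And>v x. x \<in> S \<Longrightarrow> norm (?f' x v) \<le> B v"
    by metis
  define L where "L = (\<Sum>b\<in>Basis. \<bar>B b\<bar>)"
  have on: "onorm (?f' x) \<le> L" if x: "x \<in> S" for x
  proof (rule onorm_le)
    fix v
    interpret bounded_linear "?f' x" using diff by (rule has_derivative_bounded_linear)
    have "?f' x v = (\<Sum>b\<in>Basis. (v \<bullet> b) *\<^sub>R ?f' x b)"
      by (subst (1) euclidean_representation[of v, symmetric]) (simp only: sum scaleR)
    also have "norm \<dots> \<le> (\<Sum>b\<in>Basis. norm v * \<bar>B b\<bar>)"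
    proof (rule sum_norm_le)
      fix b :: 'a assume "b \<in> Basis"
      then show "norm ((v \<bullet> b) *\<^sub>R ?f' x b) \<le> norm v * \<bar>B b\<bar>"
        using B[OF x, of b] by (auto intro!: mult_mono Basis_le_norm)
    qed
    also have "\<dots> = L * norm v"
      by (simp add: L_def sum_distrib_left mult.commute)
    finally show "norm (?f' x v) \<le> L * norm v" .
  qed
  have "L-lipschitz_on S f"
  proof (rule lipschitz_onI)
    show "dist (f x) (f y) \<le> L * dist x y" if "x \<in> S" "y \<in> S" for x y
      unfolding dist_norm
      by (rule differentiable_bound[OF S(2) has_derivative_at_withinI[OF diff] on]) (use that in auto)
    show "0 \<le> L" by (simp add: L_def sum_nonneg)
  qed
  then show ?thesis ..
qed

section \<open>Separating polynomials\<close>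

lemma finite_multi_indices: "finite (multi_indices m :: ('n::finite \<Rightarrow> nat) set)"
proof (rule finite_subset)
  show "multi_indices m \<subseteq> Pi\<^sub>E (UNIV :: 'n set) (\<lambda>_. {..m})"
  proof
    fix \<alpha> :: "'n \<Rightarrow> nat" assume "\<alpha> \<in> multi_indices m"
    then have "\<alpha> i \<le> m" for i
      using member_le_sum[of i UNIV \<alpha>] by (auto simp: multi_indices_def)
    then show "\<alpha> \<in> Pi\<^sub>E (UNIV :: 'n set) (\<lambda>_. {..m})" by auto
  qed
qed (auto intro!: finite_PiE)

text \<open>Polynomials of total degree at most \<open>m\<close>, kept as functions; a coefficient
  vector is extracted only when it is to serve as a direction in parameter space.\<close>

definition poly_fun :: "nat \<Rightarrow> (real^'n::finite \<Rightarrow> real) \<Rightarrow> bool" where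
  "poly_fun m f \<longleftrightarrow> (\<exists>\<gamma>. \<forall>x. f x = (\<Sum>\<alpha>\<in>multi_indices m. \<gamma> \<alpha> * monom \<alpha> x))"

lemma poly_fun_const: "poly_fun 0 (\<lambda>x::real^'n::finite. k)"
proof -
  have "multi_indices 0 = {\<lambda>_::'n. 0}"
    by (auto simp: multi_indices_def fun_eq_iff)
  then show ?thesis
    unfolding poly_fun_def by (intro exI[of _ "\<lambda>_. k"]) (simp add: monom_def)
qed

lemma poly_fun_add:
  assumes "poly_fun m f" "poly_fun m g"
  shows "poly_fun m (\<lambda>x. f x + g x)"
proof -
  obtain \<gamma> \<delta> where "\<And>x. f x = (\<Sum>\<alpha>\<in>multi_indices m. \<gamma> \<alpha> * monom \<alpha> x)"
    "\<And>x. g x = (\<Sum>\<alpha>\<in>multi_indices m. \<delta> \<alpha> * monom \<alpha> x)"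
    using assms unfolding poly_fun_def by blast
  then show ?thesis
    unfolding poly_fun_def
    by (intro exI[of _ "\<lambda>\<alpha>. \<gamma> \<alpha> + \<delta> \<alpha>"]) (simp add: sum.distrib distrib_right)
qed

lemma poly_fun_scale:
  assumes "poly_fun m f"
  shows "poly_fun m (\<lambda>x. k * f x)"
proof -
  obtain \<gamma> where "\<And>x. f x = (\<Sum>\<alpha>\<in>multi_indices m. \<gamma> \<alpha> * monom \<alpha> x)"
    using assms unfolding poly_fun_def by blast
  then show ?thesis
    unfolding poly_fun_def
    by (intro exI[of _ "\<lambda>\<alpha>. k * \<gamma> \<alpha>"]) (simp add: sum_distrib_left mult.assoc)
qed

lemma poly_fun_mono:
  assumes "poly_fun m f" "m \<le> m'"
  shows "poly_fun m' f"
proof -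
  obtain \<gamma> where \<gamma>: "\<And>x. f x = (\<Sum>\<alpha>\<in>multi_indices m. \<gamma> \<alpha> * monom \<alpha> x)"
    using assms unfolding poly_fun_def by blast
  have "f x = (\<Sum>\<alpha>\<in>multi_indices m'. (if \<alpha> \<in> multi_indices m then \<gamma> \<alpha> else 0) * monom \<alpha> x)" for x
    unfolding \<gamma>
    by (rule sum.mono_neutral_cong_left[OF finite_multi_indices])
       (use assms(2) in \<open>auto simp: multi_indices_def\<close>)
  then show ?thesis
    unfolding poly_fun_def
    by (intro exI[of _ "\<lambda>\<alpha>. if \<alpha> \<in> multi_indices m then \<gamma> \<alpha> else 0"]) blast
qed

text \<open>Multiplication by a coordinate shifts every multi-index by one in position
  \<open>i\<close>; indices outside the image of the shift get coefficient zero.\<close>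

lemma poly_fun_coord_mult:
  fixes f :: "real^'n::finite \<Rightarrow> real"
  assumes "poly_fun m f"
  shows "poly_fun (Suc m) (\<lambda>x. x $ i * f x)"
proof -
  obtain \<gamma> where \<gamma>: "\<And>x. f x = (\<Sum>\<alpha>\<in>multi_indices m. \<gamma> \<alpha> * monom \<alpha> x)"
    using assms unfolding poly_fun_def by blast
  let ?up = "\<lambda>\<alpha>::'n \<Rightarrow> nat. \<alpha>(i := Suc (\<alpha> i))"
  let ?dn = "\<lambda>\<beta>::'n \<Rightarrow> nat. \<beta>(i := \<beta> i - 1)"
  \<comment> \<open>Subtraction in \<open>?dn\<close> truncates at zero, so the indices with
    \<open>\<beta> i = 0\<close> need a separate case.\<close>
  let ?c = "\<lambda>\<beta>. if \<beta> i = 0 then 0 else \<gamma> (?dn \<beta>)"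
  have sum_up: "sum (?up \<alpha>) UNIV = Suc (sum \<alpha> UNIV)" for \<alpha>
  proof -
    have "sum (?up \<alpha>) (UNIV - {i}) = sum \<alpha> (UNIV - {i})"
      by (rule sum.cong) auto
    then show ?thesis
      using sum.remove[of UNIV i "?up \<alpha>"] sum.remove[of UNIV i \<alpha>] by simp
  qed
  have monom_up: "monom (?up \<alpha>) x = x $ i * monom \<alpha> x" for \<alpha> x
  proof -
    have "(\<Prod>j\<in>UNIV - {i}. x $ j ^ ?up \<alpha> j) = (\<Prod>j\<in>UNIV - {i}. x $ j ^ \<alpha> j)"
      by (rule prod.cong) auto
    then show ?thesis
      using prod.remove[of UNIV i "\<lambda>j. x $ j ^ ?up \<alpha> j"] prod.remove[of UNIV i "\<lambda>j. x $ j ^ \<alpha> j"]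
      by (simp add: monom_def)
  qed
  have inj: "inj_on ?up (multi_indices m)"
  proof (rule inj_on_inverseI[of _ ?dn])
    fix \<alpha> show "?dn (?up \<alpha>) = \<alpha>" by auto
  qed
  have "x $ i * f x = (\<Sum>\<beta>\<in>multi_indices (Suc m). ?c \<beta> * monom \<beta> x)" for x
  proof -
    have "x $ i * f x = (\<Sum>\<alpha>\<in>multi_indices m. \<gamma> \<alpha> * monom (?up \<alpha>) x)"
      unfolding \<gamma> monom_up sum_distrib_left by (intro sum.cong refl) (simp add: mult.left_commute)
    also have "\<dots> = (\<Sum>\<beta>\<in>?up ` multi_indices m. ?c \<beta> * monom \<beta> x)"
      unfolding sum.reindex[OF inj] by (rule sum.cong) auto
    also have "\<dots> = (\<Sum>\<beta>\<in>multi_indices (Suc m). ?c \<beta> * monom \<beta> x)"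
    proof (rule sum.mono_neutral_left[OF finite_multi_indices])
      show "?up ` multi_indices m \<subseteq> multi_indices (Suc m)"
        using sum_up by (auto simp: multi_indices_def)
      show "\<forall>\<beta>\<in>multi_indices (Suc m) - ?up ` multi_indices m. ?c \<beta> * monom \<beta> x = 0"
      proof
        fix \<beta> assume \<beta>: "\<beta> \<in> multi_indices (Suc m) - ?up ` multi_indices m"
        have "\<beta> i = 0"
        proof (rule ccontr)
          assume "\<beta> i \<noteq> 0"
          then have eq: "\<beta> = ?up (?dn \<beta>)" by auto
          then have "sum \<beta> UNIV = Suc (sum (?dn \<beta>) UNIV)"
            using sum_up[of "?dn \<beta>"] by metis
          with \<beta> have "?dn \<beta> \<in> multi_indices m"
            by (auto simp: multi_indices_def)
          with eq \<beta> show False by blast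
        qed
        then show "?c \<beta> * monom \<beta> x = 0" by simp
      qed
    qed
    finally show ?thesis .
  qed
  then show ?thesis unfolding poly_fun_def by (intro exI[of _ ?c]) blast
qed

lemma poly_fun_inner_mult:
  fixes f :: "real^'n::finite \<Rightarrow> real"
  assumes "poly_fun m f"
  shows "poly_fun (Suc m) (\<lambda>x. (x \<bullet> v) * f x)"
proof -
  have "poly_fun (Suc m) (\<lambda>x. \<Sum>i\<in>A. v $ i * (x $ i * f x))" if "finite A" for A
    using that
  proof induction
    case empty
    show ?case using poly_fun_mono[OF poly_fun_const] by simp
  next
    case (insert a A)
    then show ?case
      by (simp add: poly_fun_add poly_fun_scale poly_fun_coord_mult[OF assms])
  qed
  from this[of UNIV] show ?thesis
    by (simp add: inner_vec_def sum_distrib_left sum_distrib_right mult_ac)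
qed

text \<open>Each excluded point \<open>p\<close> costs one degree: it contributes an affine factor
  in the direction \<open>q - p\<close>, scaled to be 1 at \<open>q\<close> and 0 at
  \<open>p\<close>.\<close>

lemma poly_fun_separating:
  fixes q :: "real^'n::finite"
  assumes "finite P" "q \<notin> P"
  shows "\<exists>f. poly_fun (card P) f \<and> f q = 1 \<and> (\<forall>p\<in>P. f p = 0)"
  using assms
proof induction
  case empty
  show ?case using poly_fun_const[of 1] by (intro exI[of _ "\<lambda>_. 1"]) simp
next
  case (insert p P)
  then obtain f where f: "poly_fun (card P) f" "f q = 1" "\<forall>p\<in>P. f p = 0"
    by auto
  define r where "r = (q - p) \<bullet> (q - p)"
  have r: "r \<noteq> 0" using insert.prems by (auto simp: r_def)
  define h where "h = (\<lambda>x. (1 / r) * ((x \<bullet> (q - p)) * f x) + (- (p \<bullet> (q - p)) / r) * f x)"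
  have h: "h x = ((x - p) \<bullet> (q - p)) / r * f x" for x
    by (simp add: h_def inner_diff_left field_simps r)
  have "poly_fun (Suc (card P)) h"
    unfolding h_def
    by (intro poly_fun_add poly_fun_scale poly_fun_inner_mult f(1) poly_fun_mono[OF f(1)]) simp
  moreover have "h q = 1" using f(2) r by (simp add: h r_def)
  moreover have "\<forall>p'\<in>insert p P. h p' = 0" using f(3) by (auto simp: h)
  ultimately show ?case using insert.hyps by auto
qed

section \<open>Collisions of orbits\<close>

text \<open>Injectivity cancels \<open>l\<close> common iterations, so a meeting of two orbits puts
  one starting point on the forward orbit of the other.\<close>

lemma funpow_collision:
  assumes "inj f" "l \<le> j" "(f ^^ j) x = (f ^^ l) y"
  shows "(f ^^ (j - l)) x = y"
proof -
  have "(f ^^ l) ((f ^^ (j - l)) x) = (f ^^ l) y"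
    using assms(2,3) by (metis comp_apply funpow_add le_add_diff_inverse)
  then show ?thesis using inj_fn[OF assms(1), of l] by (auto dest: injD)
qed

text \<open>The condition for interpolation at time \<open>j\<close>. The orbit of \<open>y\<close>
  is included up to the same time \<open>j\<close>, so that a perturbation can act on the one point
  and not on the other.\<close>

definition avoids :: "('a \<Rightarrow> 'a) \<Rightarrow> nat \<Rightarrow> 'a \<Rightarrow> 'a \<Rightarrow> bool" where
  "avoids f n x y \<longleftrightarrow> (\<forall>j<n. (f ^^ j) x \<notin> (\<lambda>l. (f ^^ l) x) ` {..<j} \<union> (\<lambda>l. (f ^^ l) y) ` {..j})"

text \<open>If both orders fail, each non-fixed point reaches the other in fewer than
  \<open>n\<close> steps. Two non-fixed points then have a period below \<open>2 * n\<close>; if one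
  point is fixed, injectivity makes the two equal.\<close>

lemma avoids_or_avoids:
  assumes "inj f" and "x \<noteq> y" and nf: "\<not> (f x = x \<and> f y = y)"
    and per: "\<And>p z. 1 \<le> p \<Longrightarrow> p < 2 * n \<Longrightarrow> (f ^^ p) z = z \<Longrightarrow> f z = z"
  shows "avoids f n x y \<or> avoids f n y x"
proof -
  \<comment> \<open>A return of the orbit of \<open>u\<close> to itself would be a short period, so
    the orbit of \<open>u\<close> meets that of \<open>v\<close>; cancelling iterates puts
    \<open>v\<close> on the forward orbit of \<open>u\<close>.\<close>
  have reach: "\<exists>p. 1 \<le> p \<and> p < n \<and> (f ^^ p) u = v"
    if na: "\<not> avoids f n u v" and "f u \<noteq> u" "u \<noteq> v" for u v
  proof -
    obtain j where j: "j < n"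
      "(f ^^ j) u \<in> (\<lambda>l. (f ^^ l) u) ` {..<j} \<union> (\<lambda>l. (f ^^ l) v) ` {..j}"
      using na unfolding avoids_def by blast
    show ?thesis
    proof (cases "(f ^^ j) u \<in> (\<lambda>l. (f ^^ l) u) ` {..<j}")
      case True
      then obtain l where l: "l < j" "(f ^^ j) u = (f ^^ l) u" by auto
      with funpow_collision[OF assms(1)] have "(f ^^ (j - l)) u = u" by simp
      moreover have "1 \<le> j - l" "j - l < 2 * n" using l j(1) by auto
      ultimately show ?thesis using per that(2) by blast
    next
      case False
      with j obtain l where l: "l \<le> j" "(f ^^ j) u = (f ^^ l) v" by auto
      with funpow_collision[OF assms(1)] have e: "(f ^^ (j - l)) u = v" by simp
      with that(3) have "j - l \<noteq> 0" by (metis funpow_0)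
      with e j(1) show ?thesis by (intro exI[of _ "j - l"]) auto
    qed
  qed
  have fixed: "(f ^^ p) z = z" if "f z = z" for p z
    using that by (induction p) auto
  have fixed': "z = u" if "f u = u" "(f ^^ p) z = u" for p z u
    using that fixed[OF that(1), of p] inj_fn[OF assms(1), of p] by (metis injD)
  show ?thesis
  proof (rule ccontr)
    assume "\<not> ?thesis"
    then have nx: "\<not> avoids f n x y" and ny: "\<not> avoids f n y x" by auto
    show False
    proof (cases "f x = x \<or> f y = y")
      case True
      then show False
        using nf reach[OF nx] reach[OF ny] \<open>x \<noteq> y\<close> fixed' by metis
    next
      case False
      obtain p p' where p: "1 \<le> p" "p < n" "(f ^^ p) x = y" "1 \<le> p'" "p' < n" "(f ^^ p') y = x"
        using reach[OF nx] reach[OF ny] False \<open>x \<noteq> y\<close> by metis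
      then have "(f ^^ (p' + p)) x = x" by (simp add: funpow_add)
      with per[of "p' + p" x] p False show False by simp
    qed
  qed
qed

section \<open>The triangular estimate\<close>

text \<open>A discrete Gronwall argument for \<open>e j + sum a {..<j} + t\<close>, which starts at
  no more than \<open>2 * t\<close> and grows by a factor of at most \<open>4 * M\<^sup>2\<close>
  per step.\<close>

lemma triangular_recursion_bound:
  fixes a e :: "nat \<Rightarrow> real"
  assumes a: "\<And>k. 0 \<le> a k" and e: "\<And>k. 0 \<le> e k" and t: "e 0 \<le> t" and M: "1 \<le> M"
    and stepa: "\<And>j. j < N \<Longrightarrow> a j \<le> M * (e j + sum a {..<j} + t)"
    and stepe: "\<And>j. j < N \<Longrightarrow> e (Suc j) \<le> M * (e j + sum a {..j} + t)"
  shows "sum a {..<N} \<le> 2 * (4 * M\<^sup>2 + 1) ^ N * t"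
proof -
  have t0: "0 \<le> t" using e[of 0] t by simp
  have "e j + sum a {..<j} + t \<le> 2 * (4 * M\<^sup>2 + 1) ^ j * t" if "j \<le> N" for j
    using that
  proof (induction j)
    case 0
    then show ?case using t by simp
  next
    case (Suc j)
    define u where "u = e j + sum a {..<j} + t"
    have u: "0 \<le> u" unfolding u_def using e a t0 by (intro add_nonneg_nonneg sum_nonneg) auto
    have aj: "a j \<le> M * u" using stepa[of j] Suc.prems by (simp add: u_def)
    have "e (Suc j) \<le> M * (u + a j)"
      using stepe[of j] Suc.prems by (simp add: u_def lessThan_Suc_atMost[symmetric] add_ac)
    moreover have "e (Suc j) + sum a {..<Suc j} + t \<le> e (Suc j) + (u + a j)"
      using e[of j] by (simp add: u_def)
    moreover have "u + a j \<le> M * (u + a j)"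
      using u a[of j] M mult_right_mono[of 1 M "u + a j"] by simp
    ultimately have "e (Suc j) + sum a {..<Suc j} + t \<le> 2 * M * (u + a j)"
      by (simp add: algebra_simps)
    also have "\<dots> \<le> 2 * M * (M * u + M * u)"
    proof -
      have "u \<le> M * u" using u M mult_right_mono[of 1 M u] by simp
      then show ?thesis using aj M by (intro mult_left_mono) auto
    qed
    also have "\<dots> = 4 * M\<^sup>2 * u" by (simp add: power2_eq_square)
    also have "\<dots> \<le> (4 * M\<^sup>2 + 1) * u" using u by (intro mult_right_mono) auto
    also have "\<dots> \<le> (4 * M\<^sup>2 + 1) * (2 * (4 * M\<^sup>2 + 1) ^ j * t)"
      using Suc by (intro mult_left_mono) (auto simp: u_def)
    finally show ?case by simp
  qed
  from this[of N] show ?thesis using e[of N] t0 by simp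
qed

text \<open>Two orbit pairs, each with equal delays, belong to parameters that differ by the
  coefficients \<open>\<delta>\<close> in the directions \<open>g\<close>. These directions are
  almost unit triangular along \<open>X'\<close> and \<open>Y'\<close>, so each
  \<open>\<delta> j\<close> is controlled by the orbit distances, the earlier coefficients and an
  error of order \<open>\<eta>\<close>.\<close>

lemma parameter_difference_bound:
  fixes X Y X' Y' :: "nat \<Rightarrow> real^'n::finite" and F :: "real^'n \<Rightarrow> real^'n"
    and g :: "nat \<Rightarrow> real^'n \<Rightarrow> real" and \<delta> :: "nat \<Rightarrow> real" and N :: nat
  defines "u \<equiv> \<lambda>z. \<Sum>k<N. \<delta> k * g k z"
  assumes X: "\<And>j. X (Suc j) = F (X j)" and Y: "\<And>j. Y (Suc j) = F (Y j)"
    and X': "\<And>j. X' (Suc j) = F (X' j) - u (X' j) *\<^sub>R axis i1 1"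
    and Y': "\<And>j. Y' (Suc j) = F (Y' j) - u (Y' j) *\<^sub>R axis i1 1"
    and XY: "\<And>j. j \<le> N \<Longrightarrow> X j $ i1 = Y j $ i1" and XY': "\<And>j. j \<le> N \<Longrightarrow> X' j $ i1 = Y' j $ i1"
    and F: "L-lipschitz_on S F"
    and S: "\<And>j. j < N \<Longrightarrow> X j \<in> S" "\<And>j. j < N \<Longrightarrow> Y j \<in> S"
           "\<And>j. j < N \<Longrightarrow> X' j \<in> S" "\<And>j. j < N \<Longrightarrow> Y' j \<in> S"
    and G: "\<And>k z. k < N \<Longrightarrow> z \<in> S \<Longrightarrow> \<bar>g k z\<bar> \<le> G" and G0: "0 \<le> G"
    and gX: "\<And>j k. j < k \<Longrightarrow> k < N \<Longrightarrow> \<bar>g k (X' j)\<bar> \<le> \<eta>"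
    and gY: "\<And>j k. j \<le> k \<Longrightarrow> k < N \<Longrightarrow> \<bar>g k (Y' j)\<bar> \<le> \<eta>"
    and g1: "\<And>k. k < N \<Longrightarrow> \<bar>g k (X' k) - 1\<bar> \<le> \<eta>"
    and \<eta>: "0 \<le> \<eta>" "8 * (4 * (1 + L + 2 * G)\<^sup>2 + 1) ^ N * \<eta> \<le> 1"
  shows "(\<Sum>k<N. \<bar>\<delta> k\<bar>)
    \<le> 4 * (4 * (1 + L + 2 * G)\<^sup>2 + 1) ^ N * (norm (X 0 - X' 0) + norm (Y 0 - Y' 0))"
proof -
  define M where "M = 1 + L + 2 * G"
  define e where "e = (\<lambda>j. norm (X j - X' j) + norm (Y j - Y' j))"
  define a where "a = (\<lambda>k. \<bar>\<delta> k\<bar>)"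
  define A where "A = (\<Sum>k<N. a k)"
  \<comment> \<open>The errors from inexact triangularity involve the full sum \<open>A\<close>;
    they are lumped with the initial distance and absorbed at the end.\<close>
  define t where "t = e 0 + 2 * \<eta> * A"
  have L0: "0 \<le> L" using F by (rule lipschitz_on_nonneg)
  have M1: "1 \<le> M" and LM: "L \<le> M" and GM: "2 * G \<le> M" using L0 G0 by (auto simp: M_def)
  have a0: "0 \<le> a k" and e0: "0 \<le> e k" for k by (auto simp: a_def e_def)
  have A0: "0 \<le> A" unfolding A_def by (intro sum_nonneg a0)
  have tA: "2 * \<eta> * A \<le> t" and t0: "0 \<le> t" using e0[of 0] A0 \<eta>(1) by (auto simp: t_def)
  have split: "(\<Sum>k<N. a k * b k) \<le> H * sum a {..<m} + \<eta>' * A"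
    if "m \<le> N" "\<And>k. k < m \<Longrightarrow> b k \<le> H" "\<And>k. m \<le> k \<Longrightarrow> k < N \<Longrightarrow> b k \<le> \<eta>'" "0 \<le> \<eta>'"
    for b H m \<eta>'
  proof -
    have "(\<Sum>k<N. a k * b k) = (\<Sum>k<m. a k * b k) + (\<Sum>k=m..<N. a k * b k)"
      using that(1) by (metis sum.atLeastLessThan_concat atLeast0LessThan zero_le)
    also have "(\<Sum>k<m. a k * b k) \<le> (\<Sum>k<m. H * a k)"
      using that(2) a0 by (intro sum_mono) (subst mult.commute, auto intro: mult_right_mono)
    also have "(\<Sum>k=m..<N. a k * b k) \<le> (\<Sum>k=m..<N. \<eta>' * a k)"
      using that(3) a0 by (intro sum_mono) (subst mult.commute, auto intro: mult_right_mono)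
    also have "(\<Sum>k=m..<N. \<eta>' * a k) \<le> (\<Sum>k<N. \<eta>' * a k)"
      using that(4) a0 by (intro sum_mono2) auto
    finally show ?thesis by (simp add: sum_distrib_left A_def)
  qed
  \<comment> \<open>At time \<open>j\<close> only the directions with index up to \<open>j\<close>
    may exceed \<open>\<eta>\<close>; the cut at \<open>Suc j\<close> serves both orbits.\<close>
  have ubound: "\<bar>u z\<bar> \<le> G * sum a {..<Suc j} + \<eta> * A"
    if "j < N" "z \<in> S" "\<And>k. j < k \<Longrightarrow> k < N \<Longrightarrow> \<bar>g k z\<bar> \<le> \<eta>" for j z
  proof -
    have "\<bar>u z\<bar> \<le> (\<Sum>k<N. a k * \<bar>g k z\<bar>)"
      unfolding u_def a_def using sum_abs[of "\<lambda>k. \<delta> k * g k z" "{..<N}"] by (simp add: abs_mult)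
    also have "\<dots> \<le> G * sum a {..<Suc j} + \<eta> * A"
      using that G \<eta>(1) by (intro split) auto
    finally show ?thesis .
  qed
  have Lip: "norm (F p - F q) \<le> L * norm (p - q)" if "p \<in> S" "q \<in> S" for p q
    using lipschitz_onD[OF F that] by (simp add: dist_norm)
  have stepe: "e (Suc j) \<le> M * (e j + sum a {..j} + t)" if j: "j < N" for j
  proof -
    have 1: "norm (X (Suc j) - X' (Suc j)) \<le> L * norm (X j - X' j) + \<bar>u (X' j)\<bar>"
    proof -
      have "X (Suc j) - X' (Suc j) = (F (X j) - F (X' j)) + u (X' j) *\<^sub>R axis i1 1"
        by (simp add: X X')
      then show ?thesis
        using norm_triangle_ineq[of "F (X j) - F (X' j)" "u (X' j) *\<^sub>R axis i1 1"]
          Lip[OF S(1,3)[OF j]] by simp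
    qed
    have 2: "norm (Y (Suc j) - Y' (Suc j)) \<le> L * norm (Y j - Y' j) + \<bar>u (Y' j)\<bar>"
    proof -
      have "Y (Suc j) - Y' (Suc j) = (F (Y j) - F (Y' j)) + u (Y' j) *\<^sub>R axis i1 1"
        by (simp add: Y Y')
      then show ?thesis
        using norm_triangle_ineq[of "F (Y j) - F (Y' j)" "u (Y' j) *\<^sub>R axis i1 1"]
          Lip[OF S(2,4)[OF j]] by simp
    qed
    have "\<bar>u (X' j)\<bar> \<le> G * sum a {..<Suc j} + \<eta> * A" "\<bar>u (Y' j)\<bar> \<le> G * sum a {..<Suc j} + \<eta> * A"
      using j gX gY S by (auto intro!: ubound simp del: sum.lessThan_Suc)
    with 1 2 have "e (Suc j) \<le> L * e j + 2 * G * sum a {..<Suc j} + 2 * \<eta> * A"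
      by (simp add: e_def algebra_simps)
    also have "\<dots> \<le> M * e j + M * sum a {..<Suc j} + M * t"
      using LM GM M1 e0 a0 tA t0 mult_right_mono[OF M1 t0]
      by (intro add_mono mult_right_mono sum_nonneg) auto
    finally show ?thesis by (simp add: distrib_left lessThan_Suc_atMost)
  qed
  have stepa: "a j \<le> M * (e j + sum a {..<j} + t)" if j: "j < N" for j
  proof -
    define w where "w = u (X' j) - u (Y' j)"
    \<comment> \<open>The delays at time \<open>Suc j\<close> agree under both parameters, so the
      difference of the perturbations is expressed by first coordinates of \<open>F\<close>
      alone.\<close>
    have "w = (F (X' j) - F (X j)) $ i1 - (F (Y' j) - F (Y j)) $ i1"
      using XY[of "Suc j"] XY'[of "Suc j"] j by (simp add: w_def X Y X' Y')
    then have "\<bar>w\<bar> \<le> norm (F (X' j) - F (X j)) + norm (F (Y' j) - F (Y j))"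
      using component_le_norm_cart[of "F (X' j) - F (X j)" i1]
        component_le_norm_cart[of "F (Y' j) - F (Y j)" i1] by linarith
    also have "\<dots> \<le> L * e j"
      using Lip[OF S(3,1)[OF j]] Lip[OF S(4,2)[OF j]]
      by (simp add: e_def norm_minus_commute distrib_left)
    finally have w: "\<bar>w\<bar> \<le> L * e j" .
    \<comment> \<open>Without the diagonal term, the factors of \<open>\<delta> k\<close> are at
      most \<open>2 * G\<close> for \<open>k < j\<close> and at most \<open>2 * \<eta>\<close> from
      \<open>j\<close> on.\<close>
    have "w - \<delta> j = (\<Sum>k<N. \<delta> k * (g k (X' j) - g k (Y' j) - (if k = j then 1 else 0)))"
    proof -
      have "(\<Sum>k<N. \<delta> k * (if k = j then 1 else 0)) = \<delta> j"
        using j by (simp add: if_distrib[of "\<lambda>x. \<delta> _ * x"] sum.delta cong: if_cong)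
      then show ?thesis
        by (simp add: w_def u_def right_diff_distrib sum_subtractf)
    qed
    then have "\<bar>w - \<delta> j\<bar> \<le> (\<Sum>k<N. a k * \<bar>g k (X' j) - g k (Y' j) - (if k = j then 1 else 0)\<bar>)"
      unfolding a_def
      using sum_abs[of "\<lambda>k. \<delta> k * (g k (X' j) - g k (Y' j) - (if k = j then 1 else 0))" "{..<N}"]
      by (simp add: abs_mult)
    also have "\<dots> \<le> 2 * G * sum a {..<j} + 2 * \<eta> * A"
    proof (rule split)
      fix k assume "k < j"
      then show "\<bar>g k (X' j) - g k (Y' j) - (if k = j then 1 else 0)\<bar> \<le> 2 * G"
        using G[of k "X' j"] G[of k "Y' j"] S(3,4)[OF j] j by auto
    next
      fix k assume k: "j \<le> k" "k < N"
      show "\<bar>g k (X' j) - g k (Y' j) - (if k = j then 1 else 0)\<bar> \<le> 2 * \<eta>"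
      proof (cases "k = j")
        case True
        then show ?thesis using g1[of j] gY[of j j] k by auto
      next
        case False
        then show ?thesis using gX[of j k] gY[of j k] k by auto
      qed
    qed (use j \<eta>(1) in auto)
    finally have "a j \<le> L * e j + 2 * G * sum a {..<j} + 2 * \<eta> * A"
      using w by (simp add: a_def)
    also have "\<dots> \<le> M * e j + M * sum a {..<j} + M * t"
      using LM GM M1 e0 a0 tA t0 mult_right_mono[OF M1 t0]
      by (intro add_mono mult_right_mono sum_nonneg) auto
    finally show ?thesis by (simp add: distrib_left)
  qed
  define Q where "Q = (4 * M\<^sup>2 + 1) ^ N"
  have "A \<le> 2 * Q * t"
    unfolding A_def Q_def
    by (rule triangular_recursion_bound[OF a0 e0 _ M1 stepa stepe])
       (use A0 \<eta>(1) in \<open>auto simp: t_def\<close>)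
  \<comment> \<open>By the choice of \<open>\<eta>\<close> at most half of \<open>A\<close> remains
    on the right; absorbing it on the left doubles the factor \<open>2 * Q\<close>.\<close>
  also have "\<dots> = 2 * Q * e 0 + (8 * Q * \<eta>) * A / 2"
    by (simp add: t_def algebra_simps)
  also have "\<dots> \<le> 2 * Q * e 0 + 1 * A / 2"
    using \<eta>(2) A0 by (intro add_left_mono divide_right_mono mult_right_mono) (auto simp: Q_def M_def)
  finally show ?thesis
    by (simp add: A_def a_def e_def Q_def M_def)
qed

section \<open>Delay maps\<close>

lemma continuous_on_monom: "continuous_on S (monom \<alpha>)"
  unfolding monom_def by (intro continuous_intros)

lemma continuous_on_phi_c_iterate:
  fixes \<phi> :: "real^'n::finite \<Rightarrow> real^'n"
  assumes "continuous_on UNIV \<phi>" "continuous_on A f" "continuous_on A h"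
  shows "continuous_on A (\<lambda>p. (phi_c i1 D \<phi> (f p) ^^ j) (h p))"
proof (induction j)
  case 0
  show ?case using assms(3) by simp
next
  case (Suc j)
  have "continuous_on A (\<lambda>p. f p \<alpha>)" for \<alpha>
    using assms(2) by (rule continuous_on_product_then_coordinatewise)
  moreover have "continuous_on A (\<lambda>p. \<phi> ((phi_c i1 D \<phi> (f p) ^^ j) (h p)))"
    by (rule continuous_on_compose2[OF assms(1) Suc.IH]) simp
  moreover have "continuous_on A (\<lambda>p. monom \<alpha> ((phi_c i1 D \<phi> (f p) ^^ j) (h p)))" for \<alpha>
    by (rule continuous_on_compose2[OF continuous_on_monom[of UNIV] Suc.IH]) simp
  ultimately have "continuous_on A (\<lambda>p. phi_c i1 D \<phi> (f p) ((phi_c i1 D \<phi> (f p) ^^ j) (h p)))"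
    unfolding phi_c_def[of i1 D \<phi> "f _" "(_ ^^ _) _"] by (intro continuous_intros)
  then show ?case by simp
qed

lemma delay_map_eq_iff:
  "delay_map i1 D \<phi> c x = delay_map i1 D \<phi> c y \<longleftrightarrow>
    (\<forall>j<D. (phi_c i1 D \<phi> c ^^ j) x $ i1 = (phi_c i1 D \<phi> c ^^ j) y $ i1)"
  by (auto simp: delay_map_def)

lemma abs_le_pnorm:
  assumes "finite I" "\<alpha> \<in> I"
  shows "\<bar>c \<alpha>\<bar> \<le> pnorm I c"
  unfolding pnorm_def
  using assms by (intro real_le_rsqrt) (auto intro!: member_le_sum[where f = "\<lambda>a. (c a)\<^sup>2"])

text \<open>\<open>phi_c\<close> is affine in \<open>c\<close>: a Lipschitz constant of
  \<open>\<phi>\<close>, the member at \<open>c = 0\<close>, and constants of the monomials,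
  weighted by the bound \<open>a\<close> on every coefficient, add up to one for the whole parameter
  ball.\<close>

lemma phi_c_lipschitz_uniform:
  fixes \<phi> :: "real^'n::finite \<Rightarrow> real^'n"
  assumes S: "compact S" "convex S" and a: "0 < a"
    and C1: "\<And>c. pnorm (multi_indices (2*D-1)) c \<le> a \<Longrightarrow> Ck 1 (phi_c i1 D \<phi> c)"
  shows "\<exists>L. \<forall>c. pnorm (multi_indices (2*D-1)) c \<le> a \<longrightarrow> L-lipschitz_on S (phi_c i1 D \<phi> c)"
proof -
  let ?I = "multi_indices (2*D-1) :: ('n \<Rightarrow> nat) set"
  have phi0: "phi_c i1 D \<phi> (\<lambda>_. 0) = \<phi>"
    by (simp add: phi_c_def fun_eq_iff)
  have "Ck 1 \<phi>" using C1[of "\<lambda>_. 0"] a by (simp add: phi0 pnorm_def)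
  then obtain L0 where L0: "L0-lipschitz_on S \<phi>"
    using Ck_imp_lipschitz_on_compact_convex[OF _ _ S] by blast
  \<comment> \<open>A monomial is, up to a scalar, the difference of two members of the family.\<close>
  have "\<exists>L. L-lipschitz_on S (monom \<alpha>)" if \<alpha>: "\<alpha> \<in> ?I" for \<alpha>
  proof -
    let ?c = "\<lambda>\<beta>. if \<beta> = \<alpha> then a else 0"
    have phi1: "phi_c i1 D \<phi> ?c x = \<phi> x + (a * monom \<alpha> x) *\<^sub>R axis i1 1" for x
      using \<alpha> by (simp add: phi_c_def if_distrib[of "\<lambda>x. x * _"] sum.delta finite_multi_indices
          cong: if_cong)
    have "pnorm ?I ?c \<le> a"
      using \<alpha> a by (simp add: pnorm_def if_distrib[of "\<lambda>x. x\<^sup>2"] sum.delta finite_multi_indices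
          cong: if_cong)
    then obtain L1 where L1: "L1-lipschitz_on S (phi_c i1 D \<phi> ?c)"
      using Ck_imp_lipschitz_on_compact_convex[OF C1 _ S] by blast
    have "((L1 + L0) / a)-lipschitz_on S (monom \<alpha>)"
    proof (rule lipschitz_onI)
      fix x y assume xy: "x \<in> S" "y \<in> S"
      have "(a * (monom \<alpha> x - monom \<alpha> y)) *\<^sub>R axis i1 1
          = (phi_c i1 D \<phi> ?c x - phi_c i1 D \<phi> ?c y) - (\<phi> x - \<phi> y)"
        by (simp add: phi1 algebra_simps)
      then have "norm ((a * (monom \<alpha> x - monom \<alpha> y)) *\<^sub>R (axis i1 1 :: real^'n))
          \<le> norm (phi_c i1 D \<phi> ?c x - phi_c i1 D \<phi> ?c y) + norm (\<phi> x - \<phi> y)"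
        by (metis norm_triangle_ineq4)
      also have "\<dots> \<le> L1 * dist x y + L0 * dist x y"
        using lipschitz_onD[OF L1 xy] lipschitz_onD[OF L0 xy] by (simp add: dist_norm)
      finally have "a * \<bar>monom \<alpha> x - monom \<alpha> y\<bar> \<le> (L1 + L0) * dist x y"
        using a by (simp add: abs_mult distrib_right)
      then show "dist (monom \<alpha> x) (monom \<alpha> y) \<le> (L1 + L0) / a * dist x y"
        using a by (simp add: dist_real_def field_simps)
    qed (use a lipschitz_on_nonneg[OF L0] lipschitz_on_nonneg[OF L1] in auto)
    then show ?thesis ..
  qed
  then obtain L where L: "\<And>\<alpha>. \<alpha> \<in> ?I \<Longrightarrow> (L \<alpha>)-lipschitz_on S (monom \<alpha>)"
    by metis
  have "(L0 + (\<Sum>\<alpha>\<in>?I. a * L \<alpha>))-lipschitz_on S (phi_c i1 D \<phi> c)" if c: "pnorm ?I c \<le> a" for c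
  proof (rule lipschitz_onI)
    fix x y assume xy: "x \<in> S" "y \<in> S"
    have "phi_c i1 D \<phi> c x - phi_c i1 D \<phi> c y
        = (\<phi> x - \<phi> y) + (\<Sum>\<alpha>\<in>?I. c \<alpha> * (monom \<alpha> x - monom \<alpha> y)) *\<^sub>R axis i1 1"
      by (simp add: phi_c_def right_diff_distrib sum_subtractf algebra_simps)
    then have "dist (phi_c i1 D \<phi> c x) (phi_c i1 D \<phi> c y)
        \<le> norm (\<phi> x - \<phi> y) + \<bar>\<Sum>\<alpha>\<in>?I. c \<alpha> * (monom \<alpha> x - monom \<alpha> y)\<bar>"
      using norm_triangle_ineq[of "\<phi> x - \<phi> y"
          "(\<Sum>\<alpha>\<in>?I. c \<alpha> * (monom \<alpha> x - monom \<alpha> y)) *\<^sub>R (axis i1 1 :: real^'n)"]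
      by (simp add: dist_norm)
    also have "\<dots> \<le> L0 * dist x y + (\<Sum>\<alpha>\<in>?I. a * (L \<alpha> * dist x y))"
    proof (rule add_mono)
      show "norm (\<phi> x - \<phi> y) \<le> L0 * dist x y"
        using lipschitz_onD[OF L0 xy] by (simp add: dist_norm)
      have "\<bar>\<Sum>\<alpha>\<in>?I. c \<alpha> * (monom \<alpha> x - monom \<alpha> y)\<bar>
          \<le> (\<Sum>\<alpha>\<in>?I. \<bar>c \<alpha> * (monom \<alpha> x - monom \<alpha> y)\<bar>)"
        by (rule sum_abs)
      also have "\<dots> \<le> (\<Sum>\<alpha>\<in>?I. a * (L \<alpha> * dist x y))"
      proof (rule sum_mono)
        fix \<alpha> assume \<alpha>: "\<alpha> \<in> ?I"
        have "\<bar>c \<alpha>\<bar> \<le> a" using abs_le_pnorm[OF finite_multi_indices \<alpha>, of c] c by simp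
        moreover have "\<bar>monom \<alpha> x - monom \<alpha> y\<bar> \<le> L \<alpha> * dist x y"
          using lipschitz_onD[OF L[OF \<alpha>] xy] by (simp add: dist_real_def)
        ultimately show "\<bar>c \<alpha> * (monom \<alpha> x - monom \<alpha> y)\<bar> \<le> a * (L \<alpha> * dist x y)"
          using a unfolding abs_mult by (intro mult_mono) auto
      qed
      finally show "\<bar>\<Sum>\<alpha>\<in>?I. c \<alpha> * (monom \<alpha> x - monom \<alpha> y)\<bar>
          \<le> (\<Sum>\<alpha>\<in>?I. a * (L \<alpha> * dist x y))" .
    qed
    finally show "dist (phi_c i1 D \<phi> c x) (phi_c i1 D \<phi> c y)
        \<le> (L0 + (\<Sum>\<alpha>\<in>?I. a * L \<alpha>)) * dist x y"
      by (simp add: distrib_right sum_distrib_right mult.assoc)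
  next
    show "0 \<le> L0 + (\<Sum>\<alpha>\<in>?I. a * L \<alpha>)"
      using lipschitz_on_nonneg[OF L0] lipschitz_on_nonneg[OF L] a
      by (intro add_nonneg_nonneg sum_nonneg mult_nonneg_nonneg) auto
  qed
  then show ?thesis by blast
qed

section \<open>Local nullity of the parameters with equal delays\<close>

text \<open>The slices run along directions that are unit triangular at \<open>(c0, x0, y0)\<close>.
  Continuity keeps them almost so on \<open>W\<close>, where the triangular estimate makes the slice
  parameter a Lipschitz function of the pair of points.\<close>

lemma equal_delays_locally_null:
  fixes \<phi> :: "real^'n::finite \<Rightarrow> real^'n" and i1 :: 'n and D :: nat
  defines "I \<equiv> multi_indices (2*D-1)"
  assumes D: "2 * CARD('n) + 2 \<le> D"
    and \<phi>: "continuous_on UNIV \<phi>" and K: "compact K" and S: "compact S"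
    and orbit: "\<And>c x j. pnorm I c \<le> a \<Longrightarrow> x \<in> K \<Longrightarrow> j < D \<Longrightarrow> (phi_c i1 D \<phi> c ^^ j) x \<in> S"
    and L: "\<And>c. pnorm I c \<le> a \<Longrightarrow> L-lipschitz_on S (phi_c i1 D \<phi> c)"
    and avoid: "avoids (phi_c i1 D \<phi> c0) (D - 1) x0 y0"
  shows "\<exists>W. open W \<and> (c0, x0, y0) \<in> W \<and>
    (AE c in PiM I (\<lambda>_. lborel). \<not> (pnorm I c \<le> a \<and>
       (\<exists>x\<in>K. \<exists>y\<in>K. (c, x, y) \<in> W \<and> delay_map i1 D \<phi> c x = delay_map i1 D \<phi> c y)))"
proof -
  let ?orb = "\<lambda>c j. phi_c i1 D \<phi> c ^^ j"
  \<comment> \<open>One more than the dimension of the space of pairs of points. With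
    \<open>N < D\<close>, equality of delays covers all times up to \<open>N\<close>.\<close>
  define N where "N = 2 * CARD('n) + 1"
  have ND: "N < D" using D by (simp add: N_def)
  have finI: "finite I" unfolding I_def by (rule finite_multi_indices)
  define interp where "interp = (\<lambda>k \<gamma>. let g = (\<lambda>z. \<Sum>\<alpha>\<in>I. \<gamma> \<alpha> * monom \<alpha> z) in
      g (?orb c0 k x0) = 1 \<and> (\<forall>j<k. g (?orb c0 j x0) = 0) \<and> (\<forall>j\<le>k. g (?orb c0 j y0) = 0))"
  have "\<exists>\<gamma>. interp k \<gamma>"
    if k: "k < N" for k
  proof -
    define P where "P = (\<lambda>l. ?orb c0 l x0) ` {..<k} \<union> (\<lambda>l. ?orb c0 l y0) ` {..k}"
    have "?orb c0 k x0 \<notin> P" using avoid k ND by (auto simp: avoids_def P_def)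
    moreover have "finite P" by (simp add: P_def)
    ultimately obtain f where f: "poly_fun (card P) f" "f (?orb c0 k x0) = 1" "\<forall>p\<in>P. f p = 0"
      using poly_fun_separating by blast
    \<comment> \<open>Separation from \<open>P\<close> takes degree at most
      \<open>2 * k + 1\<close>, and \<open>k < N < D\<close> keeps this within
      \<open>2 * D - 1\<close>.\<close>
    have "card P \<le> card {..<k} + card {..k}"
      unfolding P_def by (intro card_Un_le[THEN order_trans] add_mono card_image_le) auto
    then have "card P \<le> 2 * D - 1" using k ND by simp
    from poly_fun_mono[OF f(1) this] obtain \<gamma> where "\<And>x. f x = (\<Sum>\<alpha>\<in>I. \<gamma> \<alpha> * monom \<alpha> x)"
      unfolding poly_fun_def I_def by blast
    then show ?thesis using f(2,3) by (intro exI[of _ \<gamma>]) (auto simp: interp_def Let_def P_def)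
  qed
  then obtain \<gamma> where \<gamma>: "\<And>k. k < N \<Longrightarrow> interp k (\<gamma> k)"
    by metis
  define g where "g = (\<lambda>k z. \<Sum>\<alpha>\<in>I. \<gamma> k \<alpha> * monom \<alpha> z)"
  have g0: "g k (?orb c0 k x0) = 1" "j < k \<Longrightarrow> g k (?orb c0 j x0) = 0"
    "j \<le> k \<Longrightarrow> g k (?orb c0 j y0) = 0" if "k < N" for k j
    using \<gamma>[OF that] by (auto simp: interp_def Let_def g_def)
  have gcont: "continuous_on UNIV (g k)" for k
    unfolding g_def by (intro continuous_intros continuous_on_monom)
  have "\<exists>B. \<forall>z\<in>S. \<bar>g k z\<bar> \<le> B" for k
  proof -
    have "bounded (g k ` S)"
      by (meson S gcont compact_continuous_image compact_imp_bounded continuous_on_subset subset_UNIV)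
    then show ?thesis by (auto simp: bounded_iff)
  qed
  then obtain B where B: "\<And>k z. z \<in> S \<Longrightarrow> \<bar>g k z\<bar> \<le> B k" by metis
  define G where "G = (\<Sum>k<N. \<bar>B k\<bar>)"
  have G0: "0 \<le> G" unfolding G_def by (intro sum_nonneg) auto
  have G: "\<bar>g k z\<bar> \<le> G" if "k < N" "z \<in> S" for k z
  proof -
    have "\<bar>B k\<bar> \<le> G" unfolding G_def using that(1) by (intro member_le_sum) auto
    then show ?thesis using B[OF that(2), of k] by linarith
  qed
  define Q where "Q = (4 * (1 + L + 2 * G)\<^sup>2 + 1) ^ N"
  have Q: "1 \<le> Q" unfolding Q_def by (rule one_le_power) simp
  \<comment> \<open>The largest tolerance that \<open>parameter_difference_bound\<close>
    admits.\<close>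
  define \<eta> where "\<eta> = 1 / (8 * Q)"
  have \<eta>: "0 < \<eta>" "8 * Q * \<eta> \<le> 1" using Q by (auto simp: \<eta>_def)
  \<comment> \<open>\<open>h\<close> adds up the deviations from exact triangularity and vanishes at
    \<open>(c0, x0, y0)\<close>.\<close>
  define h where "h = (\<lambda>(c, x, y). \<Sum>k<N. (\<Sum>j<k. \<bar>g k (?orb c j x)\<bar>)
      + (\<Sum>j\<le>k. \<bar>g k (?orb c j y)\<bar>) + \<bar>g k (?orb c k x) - 1\<bar>)"
  define W where "W = {p. h p < \<eta>}"
  \<comment> \<open>A closed counterpart of \<open>W\<close> with the norm bound and equal delays
    added. Equality of delays is written as a sum of absolute values being at most 0, so that every
    condition is a non-strict inequality between continuous functions.\<close>
  define Z where "Z = {p. h p \<le> \<eta>} \<inter> {p. pnorm I (fst p) \<le> a} \<inter>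
    {p. (\<Sum>j<D. \<bar>?orb (fst p) j (fst (snd p)) $ i1 - ?orb (fst p) j (snd (snd p)) $ i1\<bar>) \<le> 0}"
  have ocx: "continuous_on UNIV (\<lambda>p. ?orb (fst p) j (fst (snd p)))"
    and ocy: "continuous_on UNIV (\<lambda>p. ?orb (fst p) j (snd (snd p)))" for j
    by (intro continuous_on_phi_c_iterate[OF \<phi>] continuous_intros)+
  have gx: "continuous_on UNIV (\<lambda>p. g k (?orb (fst p) j (fst (snd p))))"
    and gy: "continuous_on UNIV (\<lambda>p. g k (?orb (fst p) j (snd (snd p))))" for j k
    by (rule continuous_on_compose2[OF gcont ocx subset_UNIV]
        continuous_on_compose2[OF gcont ocy subset_UNIV])+
  have hcont: "continuous_on UNIV h"
    unfolding h_def case_prod_beta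
    by (intro continuous_on_sum continuous_on_add continuous_on_diff continuous_on_rabs
        continuous_on_const gx gy)
  have W: "open W"
    unfolding W_def by (rule open_Collect_less[OF hcont continuous_on_const])
  have W0: "(c0, x0, y0) \<in> W"
    using g0 \<eta>(1) by (simp add: W_def h_def)
  have fcont: "continuous_on UNIV (\<lambda>p::(('n \<Rightarrow> nat) \<Rightarrow> real) \<times> (real^'n) \<times> (real^'n). fst p \<alpha>)" for \<alpha>
    by (rule continuous_on_product_then_coordinatewise[OF continuous_on_fst[OF continuous_on_id]])
  have Z: "closed Z"
    unfolding Z_def pnorm_def
    by (intro closed_Int closed_Collect_le continuous_on_sum continuous_on_diff continuous_on_rabs
        continuous_on_const continuous_on_real_sqrt continuous_on_power continuous_on_component
        hcont fcont ocx ocy)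
  have zero: "u = 0" if "(\<Sum>j<D. \<bar>v j\<bar>) \<le> (0::real)" "i < D" "u = v i" for u v i
    using that member_le_sum[of i "{..<D}" "\<lambda>j. \<bar>v j\<bar>"] by simp
  have ZD: "pnorm I c \<le> a" "j < D \<Longrightarrow> ?orb c j x $ i1 = ?orb c j y $ i1"
    "k < N \<Longrightarrow> j < k \<Longrightarrow> \<bar>g k (?orb c j x)\<bar> \<le> \<eta>"
    "k < N \<Longrightarrow> j \<le> k \<Longrightarrow> \<bar>g k (?orb c j y)\<bar> \<le> \<eta>"
    "k < N \<Longrightarrow> \<bar>g k (?orb c k x) - 1\<bar> \<le> \<eta>"
    if z: "(c, x, y) \<in> Z" for c x y j k
  proof -
    show "pnorm I c \<le> a" using z by (simp add: Z_def)
    show "?orb c j x $ i1 = ?orb c j y $ i1" if "j < D"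
      using zero[OF _ that refl, of "\<lambda>j. ?orb c j x $ i1 - ?orb c j y $ i1"] z by (simp add: Z_def)
    let ?h = "\<lambda>k. (\<Sum>j<k. \<bar>g k (?orb c j x)\<bar>) + (\<Sum>j\<le>k. \<bar>g k (?orb c j y)\<bar>)
        + \<bar>g k (?orb c k x) - 1\<bar>"
    have hk: "?h k \<le> \<eta>" if "k < N" for k
    proof -
      have "?h k \<le> (\<Sum>k<N. ?h k)"
        using that by (intro member_le_sum) (auto intro!: add_nonneg_nonneg sum_nonneg)
      then show ?thesis using z by (simp add: Z_def h_def)
    qed
    have s1: "0 \<le> (\<Sum>j<k. \<bar>g k (?orb c j x)\<bar>)" and s2: "0 \<le> (\<Sum>j\<le>k. \<bar>g k (?orb c j y)\<bar>)"
      by (auto intro!: sum_nonneg)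
    show "\<bar>g k (?orb c k x) - 1\<bar> \<le> \<eta>" if "k < N"
      using hk[OF that] s1 s2 by linarith
    show "\<bar>g k (?orb c j x)\<bar> \<le> \<eta>" if "k < N" "j < k"
    proof -
      have "\<bar>g k (?orb c j x)\<bar> \<le> (\<Sum>j<k. \<bar>g k (?orb c j x)\<bar>)"
        using that(2) by (intro member_le_sum) auto
      then show ?thesis using hk[OF that(1)] s2 by linarith
    qed
    show "\<bar>g k (?orb c j y)\<bar> \<le> \<eta>" if "k < N" "j \<le> k"
    proof -
      have "\<bar>g k (?orb c j y)\<bar> \<le> (\<Sum>j\<le>k. \<bar>g k (?orb c j y)\<bar>)"
        using that(2) by (intro member_le_sum) auto
      then show ?thesis using hk[OF that(1)] s1 by linarith
    qed
  qed
  define C where "C = {c. \<exists>z\<in>K \<times> K. (c, z) \<in> Z}"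
  have C: "closed C"
    unfolding C_def by (intro closed_fst_image_compact Z compact_Times K)
  let ?M = "PiM I (\<lambda>_. lborel) :: (('n \<Rightarrow> nat) \<Rightarrow> real) measure"
  \<comment> \<open>A slice is parametrized by pairs of points times a line, the shape that
    \<open>negligible_if_Lipschitz_determined\<close> asks for; \<open>\<beta>\<close> numbers its
    coordinates.\<close>
  have "DIM(((real^'n) \<times> (real^'n)) \<times> real) = N"
    by (simp add: N_def)
  then obtain \<beta> where \<beta>: "bij_betw \<beta> {..<N} (Basis :: (((real^'n) \<times> (real^'n)) \<times> real) set)"
    using ex_bij_betw_nat_finite[of "Basis :: (((real^'n) \<times> (real^'n)) \<times> real) set"] finite_Basis
    by (metis atLeast0LessThan)
  \<comment> \<open>Coordinate \<open>k\<close> of \<open>s\<close> moves the parameter along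
    \<open>\<gamma> k\<close>, that is, it adds a multiple of \<open>g k\<close> to the
    perturbation.\<close>
  define w where "w = (\<lambda>s \<alpha>. \<Sum>k<N. (s \<bullet> \<beta> k) * \<gamma> k \<alpha>)"
  have "C \<inter> space ?M \<in> null_sets ?M"
  proof (rule null_sets_PiM_if_null_slices[where w = w])
    show "C \<inter> space ?M \<in> sets ?M" by (rule closed_Int_space_in_sets_PiM[OF C])
    show "(\<lambda>s. w s \<alpha>) \<in> borel_measurable borel" for \<alpha>
      unfolding w_def by measurable
    fix c
    let ?c = "\<lambda>s. \<lambda>\<alpha>\<in>I. c \<alpha> + w s \<alpha>"
    have diff: "norm (s - s') \<le> (8 * Q) * norm (z - z')"
      if z: "z \<in> K \<times> K" "(?c s, z) \<in> Z" and z': "z' \<in> K \<times> K" "(?c s', z') \<in> Z" for s s' z z'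
    proof -
      obtain x y x' y' where xy: "z = (x, y)" "z' = (x', y')" by fastforce
      \<comment> \<open>This brings the two maps into the form of
        \<open>parameter_difference_bound\<close>, with the coordinates of \<open>s - s'\<close> as
        \<open>\<delta>\<close>.\<close>
      have phi_diff: "phi_c i1 D \<phi> (?c s') p
          = phi_c i1 D \<phi> (?c s) p - (\<Sum>k<N. ((s - s') \<bullet> \<beta> k) * g k p) *\<^sub>R axis i1 1" for p
      proof -
        have "(\<Sum>k<N. ((s - s') \<bullet> \<beta> k) * g k p)
            = (\<Sum>\<alpha>\<in>I. (\<Sum>k<N. ((s - s') \<bullet> \<beta> k) * \<gamma> k \<alpha>) * monom \<alpha> p)"
          unfolding g_def sum_distrib_left sum_distrib_right by (subst sum.swap) (simp add: mult.assoc)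
        also have "\<dots> = (\<Sum>\<alpha>\<in>I. (?c s \<alpha> - ?c s' \<alpha>) * monom \<alpha> p)"
          by (intro sum.cong) (auto simp: w_def inner_diff_left left_diff_distrib sum_subtractf)
        also have "\<dots> = (\<Sum>\<alpha>\<in>I. ?c s \<alpha> * monom \<alpha> p) - (\<Sum>\<alpha>\<in>I. ?c s' \<alpha> * monom \<alpha> p)"
          by (simp only: left_diff_distrib sum_subtractf)
        finally show ?thesis
          unfolding phi_c_def I_def[symmetric] by (simp add: scaleR_left_diff_distrib del: restrict_apply)
      qed
      have "norm (s - s') \<le> (\<Sum>b\<in>Basis. \<bar>(s - s') \<bullet> b\<bar>)"
        by (rule norm_le_l1)
      also have "\<dots> = (\<Sum>k<N. \<bar>(s - s') \<bullet> \<beta> k\<bar>)"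
        using sum.reindex_bij_betw[OF \<beta>, of "\<lambda>b. \<bar>(s - s') \<bullet> b\<bar>"] by simp
      also have "\<dots> \<le> 4 * (4 * (1 + L + 2 * G)\<^sup>2 + 1) ^ N *
          (norm (?orb (?c s) 0 x - ?orb (?c s') 0 x') + norm (?orb (?c s) 0 y - ?orb (?c s') 0 y'))"
      proof (rule parameter_difference_bound[where F = "phi_c i1 D \<phi> (?c s)" and g = g
            and S = S and \<eta> = \<eta> and ?i1.0 = i1
            and X = "\<lambda>j. ?orb (?c s) j x" and Y = "\<lambda>j. ?orb (?c s) j y"
            and X' = "\<lambda>j. ?orb (?c s') j x'" and Y' = "\<lambda>j. ?orb (?c s') j y'"])
        show "?orb (?c s') (Suc j) p = phi_c i1 D \<phi> (?c s) (?orb (?c s') j p)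
          - (\<Sum>k<N. ((s - s') \<bullet> \<beta> k) * g k (?orb (?c s') j p)) *\<^sub>R axis i1 1" for j p
          by (simp only: funpow.simps comp_apply phi_diff)
        then show "?orb (?c s') (Suc j) p = phi_c i1 D \<phi> (?c s) (?orb (?c s') j p)
          - (\<Sum>k<N. ((s - s') \<bullet> \<beta> k) * g k (?orb (?c s') j p)) *\<^sub>R axis i1 1" for j p .
        show "L-lipschitz_on S (phi_c i1 D \<phi> (?c s))"
          using ZD(1) z(2) xy L by blast
        show "?orb (?c s) j x $ i1 = ?orb (?c s) j y $ i1" if "j \<le> N" for j
          using ZD(2) z(2) xy(1) that ND by (meson le_less_trans)
        show "?orb (?c s') j x' $ i1 = ?orb (?c s') j y' $ i1" if "j \<le> N" for j
          using ZD(2) z'(2) xy(2) that ND by (meson le_less_trans)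
        show "?orb (?c s) j x \<in> S" "?orb (?c s) j y \<in> S"
          "?orb (?c s') j x' \<in> S" "?orb (?c s') j y' \<in> S" if "j < N" for j
          using orbit ZD(1) z z' xy that ND less_trans by blast+
        show "\<bar>g k (?orb (?c s') j x')\<bar> \<le> \<eta>" if "j < k" "k < N" for j k
          using ZD(3) z'(2) xy(2) that by blast
        show "\<bar>g k (?orb (?c s') j y')\<bar> \<le> \<eta>" if "j \<le> k" "k < N" for j k
          using ZD(4) z'(2) xy(2) that by blast
        show "\<bar>g k (?orb (?c s') k x') - 1\<bar> \<le> \<eta>" if "k < N" for k
          using ZD(5) z'(2) xy(2) that by blast
      qed (use G G0 \<eta> in \<open>auto simp: Q_def\<close>)
      also have "\<dots> = 4 * Q * (norm (x - x') + norm (y - y'))"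
        by (simp add: Q_def)
      \<comment> \<open>Each component of \<open>z - z'\<close> has norm at most that of the pair,
        whence the constant \<open>8 * Q\<close>.\<close>
      also have "\<dots> \<le> 4 * Q * (norm (z - z') + norm (z - z'))"
        using Q norm_fst_le[of "x - x'" "y - y'"] norm_snd_le[of "y - y'" "x - x'"]
        by (intro mult_left_mono add_mono) (auto simp: xy)
      finally show ?thesis by simp
    qed
    show "negligible {s. ?c s \<in> C \<inter> space ?M}"
    proof (rule negligible_if_Lipschitz_determined)
      show "norm (s - s') \<le> 8 * Q * norm (z - z')"
        if "z \<in> K \<times> K \<and> (?c s, z) \<in> Z" "z' \<in> K \<times> K \<and> (?c s', z') \<in> Z" for s s' z z'
        using that diff by blast
      show "\<exists>z. z \<in> K \<times> K \<and> (?c s, z) \<in> Z" if "s \<in> {s. ?c s \<in> C \<inter> space ?M}" for s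
        using that unfolding C_def by blast
    qed
  qed (rule finI)
  then have "AE c in ?M. c \<notin> C \<inter> space ?M"
    by (rule AE_not_in)
  with AE_space have "AE c in ?M. \<not> (pnorm I c \<le> a \<and>
       (\<exists>x\<in>K. \<exists>y\<in>K. (c, x, y) \<in> W \<and> delay_map i1 D \<phi> c x = delay_map i1 D \<phi> c y))"
  proof eventually_elim
    case (elim c)
    have "(c, x, y) \<in> Z" if "pnorm I c \<le> a" "(c, x, y) \<in> W"
      "delay_map i1 D \<phi> c x = delay_map i1 D \<phi> c y" for x y
      using that by (simp add: Z_def W_def delay_map_eq_iff)
    with elim show ?case unfolding C_def by blast
  qed
  with W W0 show ?thesis by blast
qed

section \<open>Countable covering and conclusion\<close>

text \<open>The product of \<open>lborel\<close> over the finite set of multi-indices is Lebesgue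
  measure on the parameter space, so the almost everywhere statement expresses probability one
  relative to the ball.\<close>

theorem theorem19:
  fixes \<phi> :: "real^'n::finite \<Rightarrow> real^'n"
    and i1 :: 'n
    and D m :: nat
    and K Kp :: "(real^'n) set"
    and a0 :: real
  assumes D_ge: "D \<ge> 4 * CARD('n) + 2"
    and phi_diffeo: "diffeo \<phi>"
    and K_ball: "\<exists>r. K = cball 0 r"
    and Kp_ball: "\<exists>z R. Kp = cball z R"
    and K_sub: "K \<subseteq> Kp"
    and K_orbit: "\<And>x j. x \<in> K \<Longrightarrow> j \<le> D - 1 \<Longrightarrow> (\<phi> ^^ j) x \<in> Kp"
    and a0_pos: "a0 > 0"
    and Kc_orbit: "\<And>c x j. pnorm (multi_indices (2*D-1)) c \<le> a0 \<Longrightarrow> x \<in> K \<Longrightarrow> j \<le> D - 1 \<Longrightarrow>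
                      (phi_c i1 D \<phi> c ^^ j) x \<in> Kp"
    and A1: "\<And>c. pnorm (multi_indices (2*D-1)) c \<le> a0 \<Longrightarrow> Ck_diffeo 3 (phi_c i1 D \<phi> c)"
    and A2: "\<And>c. pnorm (multi_indices (2*D-1)) c \<le> a0 \<Longrightarrow>
                  finite {x. phi_c i1 D \<phi> c x = x} \<and> card {x. phi_c i1 D \<phi> c x = x} = m"
    and A3: "\<And>c x p. pnorm (multi_indices (2*D-1)) c \<le> a0 \<Longrightarrow> 1 \<le> p \<Longrightarrow> p < 2*D \<Longrightarrow>
                  (phi_c i1 D \<phi> c ^^ p) x = x \<Longrightarrow> phi_c i1 D \<phi> c x = x"
    and A4: "\<And>c x. pnorm (multi_indices (2*D-1)) c \<le> a0 \<Longrightarrow> phi_c i1 D \<phi> c x = x \<Longrightarrow>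
                  hyperbolic_fixpoint (phi_c i1 D \<phi> c) x"
    and A4': "\<And>c. pnorm (multi_indices (2*D-1)) c \<le> a0 \<Longrightarrow>
                  inj_on (\<lambda>x. x $ i1) {x. phi_c i1 D \<phi> c x = x}"
    and A5: "\<And>c x. pnorm (multi_indices (2*D-1)) c \<le> a0 \<Longrightarrow> phi_c i1 D \<phi> c x = x \<Longrightarrow>
                  delay_immersive i1 D (phi_c i1 D \<phi> c) x"
  shows "AE c in PiM (multi_indices (2*D-1)) (\<lambda>_. lborel).
           pnorm (multi_indices (2*D-1)) c < a0 \<longrightarrow> inj_on (delay_map i1 D \<phi> c) K"
proof -
  let ?I = "multi_indices (2*D-1) :: ('n \<Rightarrow> nat) set"
  let ?M = "PiM ?I (\<lambda>_. lborel) :: (('n \<Rightarrow> nat) \<Rightarrow> real) measure"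
  let ?eq = "\<lambda>c x y. delay_map i1 D \<phi> c x = delay_map i1 D \<phi> c y"
  obtain r z R where K: "K = cball 0 r" and Kp: "Kp = cball z R"
    using K_ball Kp_ball by blast
  have "Ck 1 \<phi>" using phi_diffeo by (simp add: diffeo_def Ck_diffeo_def)
  then have "continuous_on UNIV (iter_dderiv \<phi> [])"
    unfolding Ck_def by (metis list.size(3) zero_le)
  then have cont: "continuous_on UNIV \<phi>" by simp
  have "Ck 1 (phi_c i1 D \<phi> c)" if "pnorm ?I c \<le> a0" for c
    by (rule Ck_mono[of 3]) (use A1[OF that] in \<open>simp_all add: Ck_diffeo_def\<close>)
  then obtain L where L: "\<And>c. pnorm ?I c \<le> a0 \<Longrightarrow> L-lipschitz_on Kp (phi_c i1 D \<phi> c)"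
    using phi_c_lipschitz_uniform[of Kp a0 D i1 \<phi>] a0_pos unfolding Kp by auto
  \<comment> \<open>Open sets of triples that contain bad pairs only for a null set of
    parameters.\<close>
  define null where "null = (\<lambda>W. open W \<and> (AE c in ?M. \<not> (pnorm ?I c \<le> a0 \<and>
       (\<exists>x\<in>K. \<exists>y\<in>K. (c, x, y) \<in> W \<and> ?eq c x y))))"
  have loc: "\<exists>W. null W \<and> (c, x, y) \<in> W" if "avoids (phi_c i1 D \<phi> c) (D - 1) x y" for c x y
  proof -
    have orbit: "(phi_c i1 D \<phi> c ^^ j) x \<in> Kp" if "pnorm ?I c \<le> a0" "x \<in> K" "j < D" for c x j
      using Kc_orbit[OF that(1,2)] that(3) by simp
    have "2 * CARD('n) + 2 \<le> D" "compact K" "compact Kp"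
      using D_ge by (simp_all add: K Kp)
    from equal_delays_locally_null[OF this(1) cont this(2,3) orbit L that]
    show ?thesis unfolding null_def by blast
  qed
  \<comment> \<open>Countably many of these sets have the same union as all of them, so their
    exceptional parameters together still form a null set.\<close>
  obtain \<F> where \<F>: "\<F> \<subseteq> Collect null" "countable \<F>" "\<Union>\<F> = \<Union>(Collect null)"
    using Lindelof[of "Collect null"] by (auto simp: null_def)
  have "AE c in ?M. \<forall>W\<in>\<F>. \<not> (pnorm ?I c \<le> a0 \<and> (\<exists>x\<in>K. \<exists>y\<in>K. (c, x, y) \<in> W \<and> ?eq c x y))"
    using \<F>(1) by (subst AE_ball_countable[OF \<F>(2)]) (auto simp: null_def)
  then show ?thesis
  proof eventually_elim
    case (elim c)
    show ?case
    proof (intro impI inj_onI, rule ccontr)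
      fix x y
      assume c: "pnorm ?I c < a0" and xy: "x \<in> K" "y \<in> K" "?eq c x y" "x \<noteq> y"
      let ?f = "phi_c i1 D \<phi> c"
      have c': "pnorm ?I c \<le> a0" using c by simp
      \<comment> \<open>The delay at time 0 is the first coordinate, which tells fixed points
        apart.\<close>
      have "\<not> (?f x = x \<and> ?f y = y)"
      proof
        assume "?f x = x \<and> ?f y = y"
        moreover have "x $ i1 = y $ i1"
          using xy(3) D_ge unfolding delay_map_eq_iff
          by (metis add_2_eq_Suc' funpow_0 less_le_trans zero_less_Suc)
        ultimately show False using inj_onD[OF A4'[OF c']] xy(4) by simp
      qed
      moreover have "inj ?f" using A1[OF c'] by (simp add: Ck_diffeo_def bij_is_inj)
      \<comment> \<open>With \<open>n = D - 1\<close> the periods in question lie below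
        \<open>2 * (D - 1)\<close>, within the range of \<open>A3\<close>.\<close>
      ultimately have "avoids ?f (D - 1) x y \<or> avoids ?f (D - 1) y x"
        using xy(4) A3[OF c'] by (intro avoids_or_avoids) auto
      \<comment> \<open>Equality of delays is symmetric, so the two points may be exchanged.\<close>
      then have "\<exists>u\<in>K. \<exists>v\<in>K. ?eq c u v \<and> avoids ?f (D - 1) u v"
        using xy by metis
      then obtain u v where uv: "u \<in> K" "v \<in> K" "?eq c u v" "avoids ?f (D - 1) u v"
        by blast
      from loc[OF uv(4)] \<F>(3) obtain W where "W \<in> \<F>" "(c, u, v) \<in> W" by blast
      with elim c' uv show False by blast
    qed
  qed
qed

end
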